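(* Let $G$ be a finite group, and let $H, K\leq G$ be subgroups such that $(G:H) = (G:K) = n$. Let $s = |K\backslash G/H|$ be the number of $(K,H)$-double cosets in $G$, and let $\Delta_\sigma \cong K_{t_\sigma, t_\sigma}$ ($1\leq\sigma\leq s$) denote the connected components of the coset intersection graph $\Gamma^G_{H,K}$. Then $$P_G(H, K) = \prod_{\sigma = 1}^s \frac{t_\sigma!}{t_\sigma^{t_\sigma}},$$ where each $t_\sigma$ divides $|H|$ and $\sum_{\sigma = 1}^s t_\sigma = n$.
   Context: A left transversal for $H$ in $G$ is a set containing exactly one element of each left coset $gH$; a right transversal for $K$ in $G$ is a set containing exactly one element of each right coset $Kg$. For subgroups $H,K$ of a finite group $G$ with $(G:H)=n=(G:K)$, $\mathrm{DT}_G(H,K)$ is the set of all left transversals for $H$ in $G$ which are also right transversals for $K$ in $G$, and $P_G(H,K) := |\mathrm{DT}_G(H,K)|/|H|^n$ (the probability that a uniformly random left transversal for $H$ is also a right transversal for $K$). The coset intersection graph $\Gamma^G_{H,K}$ is the bipartite graph with vertex set the disjoint union $G/H \sqcup K\backslash G$ of the set of left cosets of $H$ and the set of right cosets of $K$; two vertices are joined by an (undirected) edge if and only if they are a left coset $gH$ and a right coset $Kg'$ with $gH\cap Kg'\neq\emptyset$. $K_{a,b}$ denotes the complete bipartite graph on $a$ and $b$ vertices. The graph has exactly $|K\backslash G/H|$ connected components, and, when $|H|=|K|$, each of them is a complete bipartite graph $K_{t,t}$ for some $t\ge 1$. *)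

theory Defs
  imports
    Complex_Main
    "HOL-Algebra.Left_Coset"
    "Graph_Theory.Graph_Theory"
begin

definition subgroup_index :: "('a, 'b) monoid_scheme \<Rightarrow> 'a set \<Rightarrow> nat" where
  "subgroup_index G H = card (lcosets\<^bsub>G\<^esub> H)"

definition double_cosets :: "('a, 'b) monoid_scheme \<Rightarrow> 'a set \<Rightarrow> 'a set \<Rightarrow> 'a set set" where
  "double_cosets G K H = (\<lambda>g. K <#>\<^bsub>G\<^esub> (g <#\<^bsub>G\<^esub> H)) ` carrier G"

definition left_transversal :: "('a, 'b) monoid_scheme \<Rightarrow> 'a set \<Rightarrow> 'a set \<Rightarrow> bool" where
  "left_transversal G H T \<longleftrightarrow> T \<subseteq> carrier G \<and> (\<forall>C \<in> lcosets\<^bsub>G\<^esub> H. \<exists>!x. x \<in> T \<inter> C)"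

definition right_transversal :: "('a, 'b) monoid_scheme \<Rightarrow> 'a set \<Rightarrow> 'a set \<Rightarrow> bool" where
  "right_transversal G K T \<longleftrightarrow> T \<subseteq> carrier G \<and> (\<forall>C \<in> rcosets\<^bsub>G\<^esub> K. \<exists>!x. x \<in> T \<inter> C)"

definition DT :: "('a, 'b) monoid_scheme \<Rightarrow> 'a set \<Rightarrow> 'a set \<Rightarrow> 'a set set" where
  "DT G H K = {T. left_transversal G H T \<and> right_transversal G K T}"

text \<open>The denominator is the number of left transversals for \<open>H\<close> in \<open>G\<close>.\<close>

definition DT_prob :: "('a, 'b) monoid_scheme \<Rightarrow> 'a set \<Rightarrow> 'a set \<Rightarrow> real" where
  "DT_prob G H K = real (card (DT G H K)) / real (card H) ^ subgroup_index G H"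

text \<open>Undirected graphs are symmetric digraphs, so every edge contributes both of its arcs.
  The two sides are tagged by \<open>Inl\<close> and \<open>Inr\<close> because a set may be both
  a left coset of \<open>H\<close> and a right coset of \<open>K\<close>.\<close>

definition coset_graph ::
    "('a, 'b) monoid_scheme \<Rightarrow> 'a set \<Rightarrow> 'a set \<Rightarrow> ('a set + 'a set) pair_pre_digraph" where
  "coset_graph G H K =
    \<lparr> pverts = (lcosets\<^bsub>G\<^esub> H) <+> (rcosets\<^bsub>G\<^esub> K),
      parcs = {(Inl A, Inr B) | A B. A \<in> lcosets\<^bsub>G\<^esub> H \<and> B \<in> rcosets\<^bsub>G\<^esub> K \<and> A \<inter> B \<noteq> {}}
            \<union> {(Inr B, Inl A) | A B. A \<in> lcosets\<^bsub>G\<^esub> H \<and> B \<in> rcosets\<^bsub>G\<^esub> K \<and> A \<inter> B \<noteq> {}} \<rparr>"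

definition components :: "('v, 'e) pre_digraph \<Rightarrow> ('v, 'e) pre_digraph set" where
  "components X = {C. pre_digraph.max_subgraph X Digraph_Component.connected C}"

definition component_enum :: "('a, 'b) monoid_scheme \<Rightarrow> 'a set \<Rightarrow> 'a set \<Rightarrow>
    (nat \<Rightarrow> ('a set + 'a set, ('a set + 'a set) \<times> ('a set + 'a set)) pre_digraph) \<Rightarrow>
    (nat \<Rightarrow> nat) \<Rightarrow> bool" where
  "component_enum G H K \<Delta> t \<longleftrightarrow>
    bij_betw \<Delta> {1..card (double_cosets G K H)} (components (with_proj (coset_graph G H K))) \<and>
    (\<forall>\<sigma> \<in> {1..card (double_cosets G K H)}. complete_bipartite_digraph (t \<sigma>) (t \<sigma>) (\<Delta> \<sigma>))"

end

theory Submission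
  imports Defs "HOL-Library.Disjoint_Sets" "HOL-Library.FuncSet"
begin

text \<open>Let \<open>D\<close> be a \<open>(K, H)\<close>-double coset. Any left coset of \<open>H\<close> and any right coset of \<open>K\<close>
  inside \<open>D\<close> meet, and all these intersections have the same size \<open>m\<close>. As \<open>|H| = |K|\<close>, \<open>D\<close> contains
  equally many, \<open>t\<close> say, cosets of either kind, and \<open>t m = |H|\<close>. So the components of the coset
  intersection graph correspond to the double cosets, and a common transversal restricts to each \<open>D\<close>
  independently as a matching of the \<open>t\<close> left with the \<open>t\<close> right cosets together with a choice of one
  of \<open>m\<close> elements for each matched pair: \<open>t! m^t\<close> possibilities out of \<open>|H|^t = (t m)^t\<close>.\<close>

section \<open>Common transversals of two partitions\<close>

text \<open>Stated for arbitrary families of sets rather than for cosets: the count below deletes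
  one block from each family, and what remains is no longer the full set of cosets of a
  subgroup.\<close>

definition common_transversals :: "'a set set \<Rightarrow> 'a set set \<Rightarrow> 'a set set" where
  "common_transversals L R =
    {T. T \<subseteq> \<Union>L \<inter> \<Union>R \<and> (\<forall>A\<in>L. \<exists>!x. x \<in> T \<inter> A) \<and> (\<forall>B\<in>R. \<exists>!x. x \<in> T \<inter> B)}"

lemma common_transversalsI:
  assumes "T \<subseteq> \<Union>L" "T \<subseteq> \<Union>R"
    and "\<And>A. A \<in> L \<Longrightarrow> \<exists>!x. x \<in> T \<inter> A" "\<And>B. B \<in> R \<Longrightarrow> \<exists>!x. x \<in> T \<inter> B"
  shows "T \<in> common_transversals L R"
  using assms by (simp add: common_transversals_def)

lemma common_transversalsD:
  assumes "T \<in> common_transversals L R"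
  shows "T \<subseteq> \<Union>L" "T \<subseteq> \<Union>R"
    and "\<And>A. A \<in> L \<Longrightarrow> \<exists>!x. x \<in> T \<inter> A" "\<And>B. B \<in> R \<Longrightarrow> \<exists>!x. x \<in> T \<inter> B"
  using assms by (simp_all add: common_transversals_def)

lemma finite_common_transversals: "finite (\<Union>L) \<Longrightarrow> finite (common_transversals L R)"
  by (rule finite_subset[of _ "Pow (\<Union>L)"]) (auto simp: common_transversals_def)

lemma disjoint_mem_eq: "disjoint L \<Longrightarrow> A \<in> L \<Longrightarrow> B \<in> L \<Longrightarrow> x \<in> A \<Longrightarrow> x \<in> B \<Longrightarrow> A = B"
  by (auto simp: disjoint_def)

text \<open>By uniqueness \<open>x\<close> is the only element of \<open>T\<close> in
  \<open>A\<close> and in \<open>B\<close>, so the rest of \<open>T\<close> lies in the other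
  blocks. Disjointness keeps \<open>x\<close> out of those blocks, so their intersections with
  \<open>T\<close> do not change.\<close>

lemma common_transversals_remove:
  assumes "disjoint L" "disjoint R" "A \<in> L" "B \<in> R" "x \<in> A \<inter> B"
    and T: "T \<in> common_transversals L R" "x \<in> T"
  shows "T - {x} \<in> common_transversals (L - {A}) (R - {B})"
proof -
  have u: "\<exists>!y. y \<in> T \<inter> A" "\<exists>!y. y \<in> T \<inter> B"
    using assms by (auto simp: common_transversals_def)
  have uA: "y = x" if "y \<in> T" "y \<in> A" for y using u(1) that assms by blast
  have uB: "y = x" if "y \<in> T" "y \<in> B" for y using u(2) that assms by blast
  have sA: "T - {x} \<subseteq> \<Union>(L - {A})" using common_transversalsD(1)[OF T(1)] uA by blast
  have sB: "T - {x} \<subseteq> \<Union>(R - {B})" using common_transversalsD(2)[OF T(1)] uB by blast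
  have a: "\<exists>!y. y \<in> (T - {x}) \<inter> A'" if "A' \<in> L - {A}" for A'
  proof -
    have "x \<notin> A'" using that assms disjoint_mem_eq[of L A A' x] by auto
    then have "(T - {x}) \<inter> A' = T \<inter> A'" by auto
    then show ?thesis using that T by (auto simp: common_transversals_def)
  qed
  have b: "\<exists>!y. y \<in> (T - {x}) \<inter> B'" if "B' \<in> R - {B}" for B'
  proof -
    have "x \<notin> B'" using that assms disjoint_mem_eq[of R B B' x] by auto
    then have "(T - {x}) \<inter> B' = T \<inter> B'" by auto
    then show ?thesis using that T by (auto simp: common_transversals_def)
  qed
  show ?thesis using sA sB a b by (rule common_transversalsI)
qed

text \<open>The converse of the deletion above. The two further conclusions say that
  \<open>x\<close> and \<open>T\<close> can be read off from \<open>insert x T\<close>; they prevent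
  double counting below.\<close>

lemma common_transversals_insert:
  assumes "disjoint L" "disjoint R" "A \<in> L" "B \<in> R" "x \<in> A \<inter> B"
    and T: "T \<in> common_transversals (L - {A}) (R - {B})"
  shows "insert x T \<in> common_transversals L R" and "insert x T \<inter> A = {x}" and "x \<notin> T"
proof -
  have s: "T \<subseteq> \<Union>(L - {A}) \<inter> \<Union>(R - {B})"
    using T by (auto simp: common_transversals_def)
  have TA: "T \<inter> A = {}" using s disjoint_mem_eq[OF \<open>disjoint L\<close> _ \<open>A \<in> L\<close>] by blast
  have TB: "T \<inter> B = {}" using s disjoint_mem_eq[OF \<open>disjoint R\<close> _ \<open>B \<in> R\<close>] by blast
  show A: "insert x T \<inter> A = {x}" and "x \<notin> T" using TA assms by auto
  have B: "insert x T \<inter> B = {x}" using TB assms by auto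
  have a: "\<exists>!y. y \<in> insert x T \<inter> A'" if "A' \<in> L" for A'
  proof (cases "A' = A")
    case False
    then have "x \<notin> A'" using that assms disjoint_mem_eq[of L A A' x] by auto
    then have "insert x T \<inter> A' = T \<inter> A'" by auto
    then show ?thesis using that T False by (auto simp: common_transversals_def)
  qed (simp only: A, blast)
  have b: "\<exists>!y. y \<in> insert x T \<inter> B'" if "B' \<in> R" for B'
  proof (cases "B' = B")
    case False
    then have "x \<notin> B'" using that assms disjoint_mem_eq[of R B B' x] by auto
    then have "insert x T \<inter> B' = T \<inter> B'" by auto
    then show ?thesis using that T False by (auto simp: common_transversals_def)
  qed (simp only: B, blast)
  have "insert x T \<subseteq> \<Union>L" "insert x T \<subseteq> \<Union>R" using s assms(3-5) by blast+
  then show "insert x T \<in> common_transversals L R" using a b by (rule common_transversalsI)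
qed

text \<open>The element representing a fixed \<open>A \<in> L\<close> can be any of the \<open>t * m\<close> elements of \<open>A\<close>;
  deleting it together with \<open>A\<close> and the block of \<open>R\<close> containing it leaves the same problem
  for \<open>t - 1\<close>.\<close>

lemma card_common_transversals:
  assumes "finite (\<Union>L)" "finite R" "disjoint L" "disjoint R"
    and "card L = t" "card R = t" "finite L"
    and "\<And>A B. A \<in> L \<Longrightarrow> B \<in> R \<Longrightarrow> card (A \<inter> B) = m"
  shows "card (common_transversals L R) = fact t * m ^ t"
  using assms
proof (induction t arbitrary: L R)
  case 0
  then have "common_transversals L R = {{}}"
    by (auto simp: common_transversals_def)
  then show ?case by simp
next
  case (Suc t)
  then obtain A where A: "A \<in> L" by fastforce
  \<comment> \<open>A pair \<open>(B, x)\<close> in \<open>P\<close> records the representative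
    \<open>x\<close> of \<open>A\<close> and the block \<open>B\<close> of \<open>R\<close> that it
    also represents. \<open>F (B, x)\<close> collects the common transversals with this
    choice.\<close>
  define P where "P = Sigma R (\<lambda>B. A \<inter> B)"
  define F where "F = (\<lambda>(B, x). insert x ` common_transversals (L - {A}) (R - {B}))"
  have fA: "finite A" using Suc.prems(1) A by (meson Union_upper finite_subset)
  have fP: "finite P" unfolding P_def using Suc.prems fA by auto
  have "card P = (\<Sum>B\<in>R. card (A \<inter> B))"
    unfolding P_def using Suc.prems fA by (intro card_SigmaI) auto
  also have "\<dots> = Suc t * m" using Suc.prems A by simp
  finally have cP: "card P = Suc t * m" .
  have eq: "common_transversals L R = \<Union>(F ` P)"
  proof (intro equalityI subsetI)
    fix T assume T: "T \<in> common_transversals L R"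
    then obtain x where x: "x \<in> T" "x \<in> A"
      using common_transversalsD(3)[OF T A] by blast
    moreover from T x obtain B where B: "B \<in> R" "x \<in> B"
      using common_transversalsD(2)[OF T] by blast
    ultimately have "T - {x} \<in> common_transversals (L - {A}) (R - {B})"
      using T A Suc.prems by (intro common_transversals_remove) auto
    moreover have "T = insert x (T - {x})" using x by auto
    ultimately have "T \<in> F (B, x)" unfolding F_def by blast
    then show "T \<in> \<Union>(F ` P)" using x B unfolding P_def by blast
  next
    fix T assume "T \<in> \<Union>(F ` P)"
    then obtain B x T' where "B \<in> R" "x \<in> A \<inter> B" "T = insert x T'"
      "T' \<in> common_transversals (L - {A}) (R - {B})" unfolding F_def P_def by auto
    then show "T \<in> common_transversals L R"
      using A Suc.prems common_transversals_insert(1) by metis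
  qed
  have cF: "card (F p) = fact t * m ^ t" if "p \<in> P" for p
  proof -
    obtain B x where p: "p = (B, x)" "B \<in> R" "x \<in> A \<inter> B" using \<open>p \<in> P\<close> unfolding P_def by auto
    have "inj_on (insert x) (common_transversals (L - {A}) (R - {B}))"
      using common_transversals_insert(3)[OF Suc.prems(3,4) A p(2,3)]
      by (intro inj_onI) (metis Diff_insert_absorb)
    then have "card (F p) = card (common_transversals (L - {A}) (R - {B}))"
      unfolding F_def p(1) by (simp add: card_image)
    also have "\<dots> = fact t * m ^ t"
    proof (rule Suc.IH)
      show "finite (\<Union>(L - {A}))" using Suc.prems(1) by (rule rev_finite_subset) auto
      show "disjoint (L - {A})" "disjoint (R - {B})"
        using Suc.prems by (auto intro: pairwise_subset)
    qed (use Suc.prems A p in auto)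
    finally show ?thesis .
  qed
  \<comment> \<open>A set \<open>T\<close> in \<open>F (B, x)\<close> determines the pair:
    \<open>x\<close> is the only element of \<open>T\<close> in \<open>A\<close>, and
    \<open>B\<close> is the only block of \<open>R\<close> containing \<open>x\<close>.\<close>
  have dF: "F p \<inter> F q = {}" if pq: "p \<in> P" "q \<in> P" "p \<noteq> q" for p q
  proof (rule ccontr)
    assume "F p \<inter> F q \<noteq> {}"
    then obtain T where T: "T \<in> F p" "T \<in> F q" by auto
    have *: "T \<inter> A = {snd r} \<and> snd r \<in> fst r \<and> fst r \<in> R" if "r \<in> P" "T \<in> F r" for r
    proof -
      obtain T' where r: "fst r \<in> R" "snd r \<in> A \<inter> fst r" "T = insert (snd r) T'"
        "T' \<in> common_transversals (L - {A}) (R - {fst r})"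
        using \<open>r \<in> P\<close> \<open>T \<in> F r\<close> unfolding P_def F_def by auto
      show ?thesis
        using common_transversals_insert(2)[OF Suc.prems(3,4) A r(1,2,4)] r by simp
    qed
    have "snd p = snd q" using *[of p] *[of q] T pq by simp
    moreover have "fst p = fst q"
      using *[of p] *[of q] T pq calculation disjoint_mem_eq[OF Suc.prems(4)] by metis
    ultimately show False using pq by (simp add: prod_eq_iff)
  qed
  have "card (common_transversals L R) = (\<Sum>p\<in>P. card (F p))"
    unfolding eq
  proof (rule card_UN_disjoint[OF fP])
    show "\<forall>p\<in>P. finite (F p)"
      unfolding F_def using Suc.prems(1)
      by (auto intro!: finite_imageI finite_common_transversals elim: rev_finite_subset)
  qed (use dF in auto)
  also have "\<dots> = fact (Suc t) * m ^ Suc t" using cF cP by (simp add: algebra_simps)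
  finally show ?case .
qed

section \<open>Independence over a disjoint family of regions\<close>

text \<open>Every block of \<open>L i\<close> or \<open>R i\<close> lies in \<open>D i\<close>, and
  the \<open>D i\<close> are pairwise disjoint, so the conditions for different \<open>i\<close>
  concern disjoint parts of \<open>T\<close>. Cutting \<open>T\<close> into the pieces
  \<open>T \<inter> D i\<close> is therefore a bijection, with union as its inverse.\<close>

lemma card_common_transversals_UN:
  assumes "finite I" and "\<And>i. i \<in> I \<Longrightarrow> \<Union>(L i) = D i" "\<And>i. i \<in> I \<Longrightarrow> \<Union>(R i) = D i"
    and disj: "disjoint_family_on D I"
  shows "card (common_transversals (\<Union>i\<in>I. L i) (\<Union>i\<in>I. R i)) =
    (\<Prod>i\<in>I. card (common_transversals (L i) (R i)))"
proof -
  let ?X = "common_transversals (\<Union>i\<in>I. L i) (\<Union>i\<in>I. R i)"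
  let ?Y = "\<Pi>\<^sub>E i\<in>I. common_transversals (L i) (R i)"
  have LD: "A \<subseteq> D i" if "i \<in> I" "A \<in> L i" for A i using assms that by blast
  have RD: "A \<subseteq> D i" if "i \<in> I" "A \<in> R i" for A i using assms that by blast
  have "bij_betw (\<lambda>T. \<lambda>i\<in>I. T \<inter> D i) ?X ?Y"
  proof (rule bij_betw_byWitness[where f' = "\<lambda>f. \<Union>i\<in>I. f i"])
    show "\<forall>T\<in>?X. (\<Union>i\<in>I. (\<lambda>i\<in>I. T \<inter> D i) i) = T"
    proof
      fix T assume "T \<in> ?X"
      then have "T \<subseteq> \<Union>(\<Union>i\<in>I. L i)" by (rule common_transversalsD)
      also have "\<dots> = (\<Union>i\<in>I. \<Union>(L i))" by auto
      finally show "(\<Union>i\<in>I. (\<lambda>i\<in>I. T \<inter> D i) i) = T" using assms(2) by auto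
    qed
    \<comment> \<open>Each \<open>f j\<close> lies in \<open>D j\<close>, so cutting the union back
      to \<open>D i\<close> leaves only \<open>f i\<close>. This gives the second inverse law, and
      also shows that a block of index \<open>i\<close> meets the union only in
      \<open>f i\<close>.\<close>
    have cut: "(\<Union>j\<in>I. f j) \<inter> D i = f i" if f: "f \<in> ?Y" and i: "i \<in> I" for f i
    proof -
      have sub: "f j \<subseteq> D j" if "j \<in> I" for j
        using common_transversalsD(1)[OF PiE_mem[OF f that]] assms(2)[OF that] by simp
      have "j = i" if "j \<in> I" "x \<in> f j" "x \<in> D i" for j x
        using disjoint_family_onD[OF disj that(1) i] sub[OF that(1)] that by blast
      then show ?thesis using sub[OF i] i by auto
    qed
    show "\<forall>f\<in>?Y. (\<lambda>i\<in>I. (\<Union>i\<in>I. f i) \<inter> D i) = f"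
    proof
      fix f assume f: "f \<in> ?Y"
      show "(\<lambda>i\<in>I. (\<Union>i\<in>I. f i) \<inter> D i) = f"
        using cut[OF f] f by (intro ext) (auto simp: restrict_def PiE_def extensional_def)
    qed
    show "(\<lambda>T. \<lambda>i\<in>I. T \<inter> D i) ` ?X \<subseteq> ?Y"
    proof (intro image_subsetI PiE_I)
      fix T i assume T: "T \<in> ?X" and i: "i \<in> I"
      have "(T \<inter> D i) \<inter> A = T \<inter> A" if "A \<in> L i \<union> R i" for A
        using LD[OF i] RD[OF i] that by blast
      moreover have "\<exists>!x. x \<in> T \<inter> A" if "A \<in> L i \<union> R i" for A
        using that
      proof
        assume "A \<in> L i"
        then show ?thesis using common_transversalsD(3)[OF T, of A] i by auto
      next
        assume "A \<in> R i"
        then show ?thesis using common_transversalsD(4)[OF T, of A] i by auto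
      qed
      ultimately have "\<exists>!x. x \<in> (T \<inter> D i) \<inter> A" if "A \<in> L i \<union> R i" for A
        using that by metis
      then have "T \<inter> D i \<in> common_transversals (L i) (R i)"
        using assms(2,3)[OF i] by (intro common_transversalsI) auto
      then show "(\<lambda>i\<in>I. T \<inter> D i) i \<in> common_transversals (L i) (R i)" using i by simp
    qed auto
    show "(\<lambda>f. \<Union>i\<in>I. f i) ` ?Y \<subseteq> ?X"
    proof (intro image_subsetI)
      fix f assume f: "f \<in> ?Y"
      have ct: "f i \<in> common_transversals (L i) (R i)" if "i \<in> I" for i
        using PiE_mem[OF f that] .
      have ex1: "\<exists>!x. x \<in> (\<Union>i\<in>I. f i) \<inter> A" if A: "i \<in> I" "A \<in> L i \<union> R i" for i A
      proof -
        have "(\<Union>i\<in>I. f i) \<inter> A = f i \<inter> A"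
          using cut[OF f A(1)] LD[of i A] RD[of i A] A by blast
        then show ?thesis using ct[OF A(1)] A(2) by (auto simp: common_transversals_def)
      qed
      show "(\<Union>i\<in>I. f i) \<in> ?X"
      proof (rule common_transversalsI)
        show "(\<Union>i\<in>I. f i) \<subseteq> \<Union>(\<Union>i\<in>I. L i)" "(\<Union>i\<in>I. f i) \<subseteq> \<Union>(\<Union>i\<in>I. R i)"
          using common_transversalsD(1,2)[OF ct] by fastforce+
      next
        fix A assume "A \<in> (\<Union>i\<in>I. L i)"
        then obtain i where "i \<in> I" "A \<in> L i" by blast
        then show "\<exists>!x. x \<in> (\<Union>i\<in>I. f i) \<inter> A" by (intro ex1[of i]) auto
      next
        fix A assume "A \<in> (\<Union>i\<in>I. R i)"
        then obtain i where "i \<in> I" "A \<in> R i" by blast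
        then show "\<exists>!x. x \<in> (\<Union>i\<in>I. f i) \<inter> A" by (intro ex1[of i]) auto
      qed
    qed
  qed
  then have "card ?X = card ?Y" by (rule bij_betw_same_card)
  then show ?thesis using assms(1) by (simp add: card_PiE)
qed

section \<open>Components of graphs\<close>

text \<open>A criterion that avoids reasoning about maximality: since the members of
  \<open>F\<close> cover all arcs and do not overlap, no arc leaves a member. A connected subgraph
  meeting a member is thus contained in it, which makes the members exactly the maximal connected
  subgraphs.\<close>

lemma components_eq_partition:
  assumes sub: "\<And>C. C \<in> F \<Longrightarrow> subgraph C X"
    and conn: "\<And>C. C \<in> F \<Longrightarrow> connected C"
    and verts: "verts X \<subseteq> (\<Union>C\<in>F. verts C)" and arcs: "arcs X \<subseteq> (\<Union>C\<in>F. arcs C)"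
    and disj: "\<And>C C'. C \<in> F \<Longrightarrow> C' \<in> F \<Longrightarrow> verts C \<inter> verts C' \<noteq> {} \<Longrightarrow> C = C'"
  shows "components X = F"
proof -
  have ends: "tail C = tail X" "head C = head X" "wf_digraph C" if "subgraph C X" for C
    using that by (auto simp: subgraph_def compatible_def)
  have arcs_in: "e \<in> arcs C \<and> tail X e \<in> verts C \<and> head X e \<in> verts C"
    \<comment> \<open>Some member contains the arc, hence both of its ends; it shares a vertex with
      \<open>C\<close> and so equals \<open>C\<close>.\<close>
    if C: "C \<in> F" and e: "e \<in> arcs X" "tail X e \<in> verts C \<or> head X e \<in> verts C" for C e
  proof -
    obtain C' where C': "C' \<in> F" "e \<in> arcs C'" using arcs e by blast
    then have "tail X e \<in> verts C'" "head X e \<in> verts C'"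
      using ends[OF sub[OF C'(1)]] by (metis wf_digraph.wellformed)+
    moreover from this have "C' = C" using disj[OF C'(1) C] e by blast
    ultimately show ?thesis using C' by simp
  qed
  \<comment> \<open>Induction along a path in \<open>Y\<close> from a shared vertex
    \<open>u\<close>. Connectedness refers to the symmetric closure, so a step may run against an
    arc of \<open>Y\<close>; this is why \<open>arcs_in\<close> accepts either end of the
    arc.\<close>
  have absorb: "subgraph Y C"
    if Y: "subgraph Y X" "connected Y" and C: "C \<in> F" and meet: "verts Y \<inter> verts C \<noteq> {}" for Y C
  proof -
    have YX: "verts Y \<subseteq> verts X" "arcs Y \<subseteq> arcs X" using Y by auto
    obtain u where u: "u \<in> verts Y" "u \<in> verts C" using meet by blast
    have vs: "verts Y \<subseteq> verts C"
    proof
      fix v assume "v \<in> verts Y"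
      then have "u \<rightarrow>\<^sup>*\<^bsub>with_proj (mk_symmetric Y)\<^esub> v"
        using Y(2) u by (auto simp: connected_def)
      then have "(u, v) \<in> rtrancl_on (verts Y) (parcs (mk_symmetric Y))"
        by (simp add: reachable_def)
      then show "v \<in> verts C"
      proof (induction rule: rtrancl_on_induct)
        case base
        then show ?case using u by simp
      next
        case (step a b)
        then obtain e where "e \<in> arcs Y" "{tail Y e, head Y e} = {a, b}"
          by (auto simp: parcs_mk_symmetric)
        then show ?case using arcs_in[OF C, of e] step YX ends[OF Y(1)]
          by (metis doubleton_eq_iff subsetD)
      qed
    qed
    have "arcs Y \<subseteq> arcs C"
    proof
      fix e assume e: "e \<in> arcs Y"
      then have "tail X e \<in> verts Y" using ends[OF Y(1)] by (metis wf_digraph.wellformed(1))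
      then show "e \<in> arcs C" using arcs_in[OF C] e YX vs by blast
    qed
    then show ?thesis using vs ends[OF Y(1)] ends[OF sub[OF C]]
      by (auto simp: subgraph_def compatible_def)
  qed
  have nonempty: "verts Y \<noteq> {}" if "connected Y" for Y
    using that by (simp add: connected_def strongly_connected_def)
  \<comment> \<open>Compatibility makes the \<open>tail\<close> and \<open>head\<close> functions
    agree, so mutual subgraphs are equal as records and not only in their vertices and arcs.\<close>
  have antisym: "Y = C" if "subgraph Y C" "subgraph C Y" for Y C :: "('a, 'b) pre_digraph"
    using that by (intro pre_digraph.equality) (auto simp: subgraph_def compatible_def)
  show ?thesis
  proof (intro equalityI subsetI)
    fix Y assume "Y \<in> components X"
    then have Y: "subgraph Y X" "connected Y"
      and max: "\<And>Z. Z \<noteq> Y \<Longrightarrow> subgraph Y Z \<Longrightarrow> \<not> (subgraph Z X \<and> connected Z)"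
      by (auto simp: components_def pre_digraph.max_subgraph_def)
    obtain C where C: "C \<in> F" "verts Y \<inter> verts C \<noteq> {}"
      using nonempty[OF Y(2)] Y(1) verts by blast
    then have "C = Y" using max[of C] absorb[OF Y C] sub conn by blast
    then show "Y \<in> F" using C by simp
  next
    fix C assume C: "C \<in> F"
    have "Z = C" if "subgraph C Z" "subgraph Z X" "connected Z" for Z
    proof (rule antisym)
      have "verts Z \<inter> verts C \<noteq> {}"
        using nonempty[OF conn[OF C]] that(1) by auto
      then show "subgraph Z C" using absorb that C by blast
    qed (rule that)
    then show "C \<in> components X"
      using sub[OF C] conn[OF C] by (auto simp: components_def pre_digraph.max_subgraph_def)
  qed
qed


text \<open>Vertices on the same side are linked through a fixed vertex of the other side,
  \<open>u0\<close> or \<open>v0\<close>; positivity of \<open>m\<close> and \<open>n\<close>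
  supplies these two.\<close>

lemma complete_bipartite_digraph_connected:
  assumes "complete_bipartite_digraph m n C" "0 < m" "0 < n"
  shows "connected C"
proof -
  interpret graph C using assms by (simp add: complete_bipartite_digraph_def)
  obtain U V where UV: "verts C = U \<union> V" "card U = m" "card V = n"
    "arcs_ends C = U \<times> V \<union> V \<times> U"
    using assms(1) unfolding complete_bipartite_digraph_def by blast
  obtain u0 v0 where uv: "u0 \<in> U" "v0 \<in> V" using assms UV by fastforce
  have adj: "u \<rightarrow>\<^sup>*\<^bsub>C\<^esub> v \<and> v \<rightarrow>\<^sup>*\<^bsub>C\<^esub> u" if "u \<in> U" "v \<in> V" for u v
    using that UV(4) by (auto intro: reachable_adjI)
  have "u \<rightarrow>\<^sup>*\<^bsub>C\<^esub> v" if "u \<in> verts C" "v \<in> verts C" for u v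
    using that adj uv unfolding UV(1) by (meson UnE reachable_trans)
  then show ?thesis
    using UV(1) uv reachable_mk_symmetric_eq[OF sym_arcs]
    unfolding connected_def by (intro strongly_connectedI) auto
qed

text \<open>Applied with \<open>m = n\<close>, this shows that a graph determines the size of its
  sides, so the values \<open>t \<sigma>\<close> in an enumeration of components are forced.\<close>

lemma complete_bipartite_digraph_card_verts:
  assumes "complete_bipartite_digraph m n C"
  shows "card (verts C) = m + n"
proof -
  interpret graph C using assms by (simp add: complete_bipartite_digraph_def)
  show ?thesis using assms finite_verts unfolding complete_bipartite_digraph_def
    by (metis card_Un_disjoint finite_Un)
qed

section \<open>Cosets inside a double coset\<close>

locale equicardinal_subgroups = group G for G (structure) +
  fixes H K :: "'a set"
  assumes subgroup_H: "subgroup H G" and subgroup_K: "subgroup K G"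
    and finite_carrier: "finite (carrier G)" and card_H_eq_K: "card H = card K"
begin

abbreviation double_coset :: "'a \<Rightarrow> 'a set" where
  "double_coset x \<equiv> K <#> (x <# H)"

definition left_in :: "'a set \<Rightarrow> 'a set set" where
  "left_in D = {A \<in> lcosets H. A \<subseteq> D}"

definition right_in :: "'a set \<Rightarrow> 'a set set" where
  "right_in D = {B \<in> rcosets K. B \<subseteq> D}"

lemma H_carrier: "h \<in> H \<Longrightarrow> h \<in> carrier G"
  using subgroup_H by (rule subgroup.mem_carrier)

lemma K_carrier: "k \<in> K \<Longrightarrow> k \<in> carrier G"
  using subgroup_K by (rule subgroup.mem_carrier)

section \<open>Double cosets as classes of an equivalence relation\<close>

lemma mem_double_coset:
  assumes "x \<in> carrier G"
  shows "y \<in> double_coset x \<longleftrightarrow> (\<exists>k\<in>K. \<exists>h\<in>H. y = k \<otimes> x \<otimes> h)"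
  using assms by (auto simp: set_mult_def l_coset_def m_assoc H_carrier K_carrier)

text \<open>Transitivity and symmetry of membership in a double coset: \<open>y = k x h\<close> can
  be multiplied further on both sides, and it inverts to \<open>x = inv k y inv h\<close>. Hence any
  element can serve as the representative.\<close>

lemma double_coset_subset:
  assumes "x \<in> carrier G" "y \<in> double_coset x"
  shows "double_coset y \<subseteq> double_coset x" "x \<in> double_coset y" "y \<in> carrier G"
proof -
  obtain k h where kh: "k \<in> K" "h \<in> H" "y = k \<otimes> x \<otimes> h" using assms mem_double_coset by blast
  then show y: "y \<in> carrier G" using assms by (simp add: H_carrier K_carrier)
  show "double_coset y \<subseteq> double_coset x"
  proof
    fix z assume "z \<in> double_coset y"
    then obtain k' h' where k'h': "k' \<in> K" "h' \<in> H" "z = k' \<otimes> y \<otimes> h'"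
      using mem_double_coset[OF y] by blast
    have "z = (k' \<otimes> k) \<otimes> x \<otimes> (h \<otimes> h')"
      using assms kh k'h' by (simp add: H_carrier K_carrier m_assoc)
    then show "z \<in> double_coset x"
      using mem_double_coset[OF assms(1)] kh k'h' subgroup.m_closed[OF subgroup_H]
        subgroup.m_closed[OF subgroup_K] by blast
  qed
  have "x = inv k \<otimes> y \<otimes> inv h"
    using assms kh by (simp add: H_carrier K_carrier m_assoc inv_solve_left inv_solve_right)
  then show "x \<in> double_coset y"
    using mem_double_coset[OF y] kh subgroup.m_inv_closed[OF subgroup_H]
      subgroup.m_inv_closed[OF subgroup_K] by blast
qed

lemma double_cosetsD:
  assumes "D \<in> double_cosets G K H" "x \<in> D"
  shows "D = double_coset x" "x \<in> carrier G"
proof -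
  obtain g where g: "g \<in> carrier G" "D = double_coset g"
    using assms(1) by (auto simp: double_cosets_def)
  then have x: "x \<in> double_coset g" using assms by simp
  note * = double_coset_subset[OF g(1) x]
  show "x \<in> carrier G" by fact
  show "D = double_coset x" using * double_coset_subset(1)[OF *(3,2)] g by auto
qed

lemma double_coset_self: "x \<in> carrier G \<Longrightarrow> x \<in> double_coset x"
  using mem_double_coset[of x x] subgroup.one_closed[OF subgroup_H]
    subgroup.one_closed[OF subgroup_K] by force

lemma finite_double_cosets: "finite (double_cosets G K H)"
  using finite_carrier by (simp add: double_cosets_def)

lemma double_cosets_subset: "D \<in> double_cosets G K H \<Longrightarrow> D \<subseteq> carrier G"
  using double_cosetsD by blast

lemma double_cosets_nonempty: "D \<in> double_cosets G K H \<Longrightarrow> D \<noteq> {}"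
  using double_coset_self by (auto simp: double_cosets_def)

lemma disjoint_double_cosets: "disjoint (double_cosets G K H)"
proof (rule disjointI)
  fix D D' assume "D \<in> double_cosets G K H" "D' \<in> double_cosets G K H" "D \<noteq> D'"
  then show "D \<inter> D' = {}" using double_cosetsD(1)[of D] double_cosetsD(1)[of D'] by blast
qed

section \<open>Left and right cosets inside a double coset\<close>

lemma lcosetD:
  assumes "A \<in> lcosets H" "x \<in> A"
  shows "A = x <# H" "x \<in> carrier G"
proof -
  obtain a where a: "a \<in> carrier G" "A = a <# H" using assms by (auto simp: LCOSETS_def)
  show "A = x <# H" using a assms l_repr_independence subgroup_H by blast
  show "x \<in> carrier G" using assms lcosets_part_G[OF subgroup_H] by blast
qed

lemma rcosetD:
  assumes "B \<in> rcosets K" "x \<in> B"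
  shows "B = K #> x" "x \<in> carrier G"
proof -
  obtain b where b: "b \<in> carrier G" "B = K #> b" using assms by (auto simp: RCOSETS_def)
  show "B = K #> x" using b assms repr_independence subgroup_K by blast
  show "x \<in> carrier G" using assms rcosets_part_G[OF subgroup_K] by blast
qed

lemma lcoset_subset_double_coset:
  assumes "D \<in> double_cosets G K H" "x \<in> D"
  shows "x <# H \<subseteq> D"
proof -
  note x = double_cosetsD[OF assms]
  have "\<one> \<otimes> x \<otimes> h \<in> D" if "h \<in> H" for h
    using mem_double_coset[OF x(2)] x(1) that subgroup.one_closed[OF subgroup_K] by blast
  then show ?thesis using x(2) by (auto simp: l_coset_def)
qed

lemma rcoset_subset_double_coset:
  assumes "D \<in> double_cosets G K H" "x \<in> D"
  shows "K #> x \<subseteq> D"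
proof -
  note x = double_cosetsD[OF assms]
  have "k \<otimes> x \<otimes> \<one> \<in> D" if "k \<in> K" for k
    using mem_double_coset[OF x(2)] x(1) that subgroup.one_closed[OF subgroup_H] by blast
  then show ?thesis using x(2) by (auto simp: r_coset_def K_carrier)
qed

text \<open>A double coset is closed under right multiplication by \<open>H\<close>, so a left coset
  that meets it is contained in it.\<close>

lemma left_inI:
  assumes "D \<in> double_cosets G K H" "A \<in> lcosets H" "x \<in> A" "x \<in> D"
  shows "A \<in> left_in D"
  using assms lcosetD(1)[of A x] lcoset_subset_double_coset[of D x] by (simp add: left_in_def)

lemma right_inI:
  assumes "D \<in> double_cosets G K H" "B \<in> rcosets K" "x \<in> B" "x \<in> D"
  shows "B \<in> right_in D"
  using assms rcosetD(1)[of B x] rcoset_subset_double_coset[of D x] by (simp add: right_in_def)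

lemma lcoset_nonempty: "A \<in> lcosets H \<Longrightarrow> A \<noteq> {}"
  using lcos_self[OF _ subgroup_H] by (auto simp: LCOSETS_def)

lemma rcoset_nonempty: "B \<in> rcosets K \<Longrightarrow> B \<noteq> {}"
  using subgroup.rcosets_non_empty[OF subgroup_K] by blast

lemma Union_left_in:
  assumes "D \<in> double_cosets G K H"
  shows "\<Union>(left_in D) = D"
proof
  show "D \<subseteq> \<Union>(left_in D)"
  proof
    fix x assume x: "x \<in> D"
    then have "x \<in> \<Union>(lcosets H)"
      using double_cosets_subset[OF assms] lcosets_part_G[OF subgroup_H] by blast
    then show "x \<in> \<Union>(left_in D)" using left_inI[OF assms] x by blast
  qed
qed (auto simp: left_in_def)

lemma Union_right_in:
  assumes "D \<in> double_cosets G K H"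
  shows "\<Union>(right_in D) = D"
proof
  show "D \<subseteq> \<Union>(right_in D)"
  proof
    fix x assume x: "x \<in> D"
    then have "x \<in> \<Union>(rcosets K)"
      using double_cosets_subset[OF assms] rcosets_part_G[OF subgroup_K] by blast
    then show "x \<in> \<Union>(right_in D)" using right_inI[OF assms] x by blast
  qed
qed (auto simp: right_in_def)

lemma double_coset_exists:
  assumes "x \<in> carrier G"
  obtains D where "D \<in> double_cosets G K H" "x \<in> D"
  using assms double_coset_self by (auto simp: double_cosets_def)

lemma UN_left_in: "(\<Union>D\<in>double_cosets G K H. left_in D) = lcosets H"
proof (intro equalityI subsetI)
  fix A assume A: "A \<in> lcosets H"
  then obtain x where x: "x \<in> A" "x \<in> carrier G" using lcoset_nonempty lcosetD by blast
  then show "A \<in> (\<Union>D\<in>double_cosets G K H. left_in D)"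
    using left_inI A double_coset_exists by (metis UN_I)
qed (auto simp: left_in_def)

lemma UN_right_in: "(\<Union>D\<in>double_cosets G K H. right_in D) = rcosets K"
proof (intro equalityI subsetI)
  fix B assume B: "B \<in> rcosets K"
  then obtain x where x: "x \<in> B" "x \<in> carrier G" using rcoset_nonempty rcosetD by blast
  then show "B \<in> (\<Union>D\<in>double_cosets G K H. right_in D)"
    using right_inI B double_coset_exists by (metis UN_I)
qed (auto simp: right_in_def)

lemma disjoint_left_in: "disjoint (left_in D)"
  using lcos_disjoint[OF subgroup_H] by (auto simp: left_in_def disjoint_def)

lemma disjoint_right_in: "disjoint (right_in D)"
  using rcos_disjoint[OF subgroup_K] by (auto simp: right_in_def disjoint_def pairwise_def disjnt_def)

section \<open>Counting cosets and their intersections\<close>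

lemma finite_double_coset: "D \<in> double_cosets G K H \<Longrightarrow> finite D"
  using double_cosets_subset finite_carrier finite_subset by blast

lemma finite_left_in: "D \<in> double_cosets G K H \<Longrightarrow> finite (left_in D)"
  using Union_left_in finite_double_coset finite_UnionD by metis

lemma finite_right_in: "D \<in> double_cosets G K H \<Longrightarrow> finite (right_in D)"
  using Union_right_in finite_double_coset finite_UnionD by metis

lemma card_lcoset: "A \<in> lcosets H \<Longrightarrow> card A = card H"
  using l_card_cosets_equal[of A H] subgroup.subset[OF subgroup_H] finite_carrier by simp

lemma card_rcoset: "B \<in> rcosets K \<Longrightarrow> card B = card K"
  using card_rcosets_equal[of B K] subgroup.subset[OF subgroup_K] by simp

lemma card_H_pos: "0 < card H"
  using subgroup.finite_imp_card_positive[OF subgroup_H finite_carrier] .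

text \<open>\<open>D\<close> is partitioned both by its left cosets of \<open>H\<close> and by its
  right cosets of \<open>K\<close>, and all blocks have size \<open>card H\<close> because the two
  orders agree. Comparing the two counts gives \<open>card_right_in\<close>.\<close>

lemma card_double_coset:
  assumes "D \<in> double_cosets G K H"
  shows "card D = card (left_in D) * card H" "card D = card (right_in D) * card H"
proof -
  have "card D = sum card (left_in D)"
    using card_Union_disjoint[of "left_in D"] disjoint_left_in Union_left_in[OF assms]
      finite_double_coset[OF assms] finite_subset by (force simp: left_in_def)
  then show "card D = card (left_in D) * card H" by (simp add: left_in_def card_lcoset)
  have "card D = sum card (right_in D)"
    using card_Union_disjoint[of "right_in D"] disjoint_right_in Union_right_in[OF assms]
      finite_double_coset[OF assms] finite_subset by (force simp: right_in_def)
  then show "card D = card (right_in D) * card H"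
    by (simp add: right_in_def card_rcoset card_H_eq_K)
qed

lemma card_right_in: "D \<in> double_cosets G K H \<Longrightarrow> card (right_in D) = card (left_in D)"
  using card_double_coset[of D] card_H_pos by simp

lemma card_left_in_pos: "D \<in> double_cosets G K H \<Longrightarrow> 0 < card (left_in D)"
  using card_double_coset(1)[of D] double_cosets_nonempty finite_double_coset
  by (metis card_gt_0_iff mult_is_0 neq0_conv)

text \<open>If \<open>a' = k a h\<close> and \<open>b' = k' b h'\<close>, then \<open>x \<mapsto> k x h'\<close> maps
  \<open>aH \<inter> Kb\<close> into \<open>a'H \<inter> Kb'\<close>.\<close>

lemma card_Int_le:
  assumes D: "D \<in> double_cosets G K H"
    and "A \<in> left_in D" "A' \<in> left_in D" "B \<in> right_in D" "B' \<in> right_in D"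
  shows "card (A \<inter> B) \<le> card (A' \<inter> B')"
proof -
  have left: "\<exists>a\<in>D. A = a <# H" if "A \<in> left_in D" for A
    using that lcoset_nonempty[of A] lcosetD(1)[of A] unfolding left_in_def by blast
  have right: "\<exists>b\<in>D. B = K #> b" if "B \<in> right_in D" for B
    using that rcoset_nonempty[of B] rcosetD(1)[of B] unfolding right_in_def by blast
  obtain a a' where a: "A = a <# H" "A' = a' <# H" "a \<in> D" "a' \<in> D"
    using left[OF assms(2)] left[OF assms(3)] by blast
  obtain b b' where b: "B = K #> b" "B' = K #> b'" "b \<in> D" "b' \<in> D"
    using right[OF assms(4)] right[OF assms(5)] by blast
  have c [simp]: "a \<in> carrier G" "b \<in> carrier G" using a b D double_cosetsD by auto
  obtain k h where kh: "k \<in> K" "h \<in> H" "a' = k \<otimes> a \<otimes> h"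
    using a(4) double_cosetsD(1)[OF D a(3)] mem_double_coset[of a a'] by auto
  obtain k' h' where kh': "k' \<in> K" "h' \<in> H" "b' = k' \<otimes> b \<otimes> h'"
    using b(4) double_cosetsD(1)[OF D b(3)] mem_double_coset[of b b'] by auto
  have [simp]: "k \<in> carrier G" "h \<in> carrier G" "k' \<in> carrier G" "h' \<in> carrier G"
    using kh kh' by (simp_all add: H_carrier K_carrier)
  let ?f = "\<lambda>x. k \<otimes> x \<otimes> h'"
  have AB: "A \<inter> B \<subseteq> carrier G"
    using D assms(2) double_cosets_subset by (auto simp: left_in_def)
  have "inj_on ?f (A \<inter> B)"
  proof (rule inj_onI)
    fix x y assume "x \<in> A \<inter> B" "y \<in> A \<inter> B" and eq: "?f x = ?f y"
    then have "x \<in> carrier G" "y \<in> carrier G" using AB by blast+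
    then show "x = y" using eq by simp
  qed
  moreover have "?f ` (A \<inter> B) \<subseteq> A' \<inter> B'"
  proof (intro image_subsetI IntI)
    fix x assume x: "x \<in> A \<inter> B"
    obtain h1 where h1: "h1 \<in> H" "x = a \<otimes> h1" using x a by (auto simp: l_coset_def)
    \<comment> \<open>With \<open>x = a h1\<close>, the product \<open>k a h1 h'\<close> regroups as
      \<open>(k a h) (inv h h1 h')\<close>, whose second factor lies in \<open>H\<close>. The right
      coset is treated likewise, by inserting \<open>inv k' k'\<close>.\<close>
    have "?f x = a' \<otimes> (inv h \<otimes> h1 \<otimes> h')"
      unfolding kh(3) h1(2) using h1(1)
      by (simp add: m_assoc H_carrier) (simp add: m_assoc [symmetric] H_carrier)
    moreover have "inv h \<otimes> h1 \<otimes> h' \<in> H"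
      using h1 kh kh' subgroup_H by (simp add: subgroup.m_closed subgroup.m_inv_closed)
    ultimately show "?f x \<in> A'" unfolding a(2) l_coset_def by blast
    obtain k1 where k1: "k1 \<in> K" "x = k1 \<otimes> b" using x b by (auto simp: r_coset_def)
    have "?f x = (k \<otimes> k1 \<otimes> inv k') \<otimes> b'"
      unfolding kh'(3) k1(2) using k1(1)
      by (simp add: m_assoc K_carrier) (simp add: m_assoc [symmetric] K_carrier)
    moreover have "k \<otimes> k1 \<otimes> inv k' \<in> K"
      using k1 kh kh' subgroup_K by (simp add: subgroup.m_closed subgroup.m_inv_closed)
    ultimately show "?f x \<in> B'" unfolding b(2) r_coset_def by blast
  qed
  moreover have "finite (A' \<inter> B')"
    using finite_double_coset[OF D] assms(3) by (auto simp: left_in_def intro: finite_subset)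
  ultimately show ?thesis by (intro card_inj_on_le)
qed

text \<open>The right cosets in \<open>D\<close> cut \<open>A\<close> into pieces of equal size, and
  there are as many of them as left cosets in \<open>D\<close>.\<close>

lemma card_Int:
  assumes D: "D \<in> double_cosets G K H" and A: "A \<in> left_in D" and B: "B \<in> right_in D"
  shows "card (left_in D) * card (A \<inter> B) = card H"
proof -
  have "A \<subseteq> D" using A by (simp add: left_in_def)
  then have A_eq: "A = (\<Union>B\<in>right_in D. A \<inter> B)" using Union_right_in[OF D] by blast
  have "finite A" using \<open>A \<subseteq> D\<close> finite_double_coset[OF D] finite_subset by blast
  then have "card (\<Union>B\<in>right_in D. A \<inter> B) = (\<Sum>B\<in>right_in D. card (A \<inter> B))"
    using disjoint_right_in[of D] finite_right_in[OF D]
    by (intro card_UN_disjoint) (auto simp: disjoint_def)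
  \<comment> \<open>\<open>card_Int_le\<close> holds for any two pairs of cosets in
    \<open>D\<close>, so using it in both directions gives equality.\<close>
  also have "\<dots> = (\<Sum>_\<in>right_in D. card (A \<inter> B))"
    using card_Int_le[OF D] A B by (intro sum.cong refl antisym) auto
  also have "\<dots> = card (left_in D) * card (A \<inter> B)" by (simp add: card_right_in[OF D])
  finally show ?thesis using A_eq A card_lcoset by (simp add: left_in_def)
qed

text \<open>The cofactor is the size of an intersection \<open>A \<inter> B\<close>; positivity of
  both coset counts provides such \<open>A\<close> and \<open>B\<close>.\<close>

lemma card_left_in_dvd: "D \<in> double_cosets G K H \<Longrightarrow> card (left_in D) dvd card H"
  using card_Int card_left_in_pos card_right_in
  by (metis card.empty dvd_triv_left ex_in_conv less_irrefl)

text \<open>After multiplication by \<open>card H\<close> both sides count the elements of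
  \<open>G\<close>: the left one by double cosets, the right one by Lagrange.\<close>

lemma sum_card_left_in: "(\<Sum>D\<in>double_cosets G K H. card (left_in D)) = card (lcosets H)"
proof -
  have "card H * (\<Sum>D\<in>double_cosets G K H. card (left_in D)) = (\<Sum>D\<in>double_cosets G K H. card D)"
    by (simp add: sum_distrib_left card_double_coset(1) mult.commute)
  also have "\<dots> = card (\<Union>(double_cosets G K H))"
    using disjoint_double_cosets finite_double_coset by (simp add: card_Union_disjoint)
  also have "\<Union>(double_cosets G K H) = carrier G"
    using double_cosets_subset double_coset_exists by blast
  also have "card (carrier G) = card H * card (lcosets H)"
    using l_lagrange[OF finite_carrier subgroup_H] by (simp add: order_def mult.commute)
  finally show ?thesis using card_H_pos by simp
qed

section \<open>The probability as a product over double cosets\<close>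

lemma DT_eq_common_transversals: "DT G H K = common_transversals (lcosets H) (rcosets K)"
  using lcosets_part_G[OF subgroup_H] rcosets_part_G[OF subgroup_K]
  by (auto simp: DT_def left_transversal_def right_transversal_def common_transversals_def)

lemma card_common_transversals_double_coset:
  assumes D: "D \<in> double_cosets G K H"
  defines "t \<equiv> card (left_in D)"
  shows "card (common_transversals (left_in D) (right_in D)) = fact t * (card H div t) ^ t"
proof (rule card_common_transversals)
  fix A B assume "A \<in> left_in D" "B \<in> right_in D"
  then show "card (A \<inter> B) = card H div t"
    using card_Int[OF D] card_left_in_pos[OF D] unfolding t_def by (metis nonzero_mult_div_cancel_left not_gr0)
qed (use D in \<open>simp_all add: t_def Union_left_in finite_double_coset finite_left_in
    finite_right_in disjoint_left_in disjoint_right_in card_right_in\<close>)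

lemma DT_prob_eq:
  "DT_prob G H K = (\<Prod>D\<in>double_cosets G K H.
     fact (card (left_in D)) / real (card (left_in D)) ^ card (left_in D))"
proof -
  let ?t = "\<lambda>D. card (left_in D)"
  have "card (DT G H K) = (\<Prod>D\<in>double_cosets G K H. fact (?t D) * (card H div ?t D) ^ ?t D)"
  proof -
    have "card (DT G H K) =
        card (common_transversals (\<Union>D\<in>double_cosets G K H. left_in D)
          (\<Union>D\<in>double_cosets G K H. right_in D))"
      by (simp only: DT_eq_common_transversals UN_left_in UN_right_in)
    also have "\<dots> = (\<Prod>D\<in>double_cosets G K H. card (common_transversals (left_in D) (right_in D)))"
      using disjoint_double_cosets
      by (intro card_common_transversals_UN[where D = id])
         (auto simp: finite_double_cosets Union_left_in Union_right_in disjoint_family_on_def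
           disjoint_def)
    finally show ?thesis by (simp add: card_common_transversals_double_coset)
  qed
  \<comment> \<open>The numbers \<open>?t D\<close> sum to the index, so the denominator splits over
    the double cosets in the same way as the numerator.\<close>
  moreover have "real (card H) ^ subgroup_index G H = (\<Prod>D\<in>double_cosets G K H. real (card H) ^ ?t D)"
    by (simp add: subgroup_index_def sum_card_left_in[symmetric] power_sum)
  ultimately have "DT_prob G H K = (\<Prod>D\<in>double_cosets G K H.
      (fact (?t D) * real (card H div ?t D) ^ ?t D) / real (card H) ^ ?t D)"
    by (simp add: DT_prob_def prod_dividef)
  also have "\<dots> = (\<Prod>D\<in>double_cosets G K H. fact (?t D) / real (?t D) ^ ?t D)"
  proof (rule prod.cong)
    fix D assume D: "D \<in> double_cosets G K H"
    \<comment> \<open>The division is exact by \<open>card_left_in_dvd\<close>, so it agrees with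
      real division and the powers of \<open>card H\<close> cancel.\<close>
    have "real (card H div ?t D) = real (card H) / real (?t D)"
      using card_left_in_dvd[OF D] by (rule real_of_nat_div)
    then show "(fact (?t D) * real (card H div ?t D) ^ ?t D) / real (card H) ^ ?t D =
        fact (?t D) / real (?t D) ^ ?t D"
      using card_H_pos by (simp add: power_divide)
  qed simp
  finally show ?thesis .
qed

subsection \<open>The coset intersection graph\<close>

text \<open>All left cosets in \<open>D\<close> are joined to all right cosets in \<open>D\<close>
  outright, which makes complete bipartiteness immediate. That these are edges of the coset graph
  rests on \<open>Int_nonempty\<close>.\<close>

definition component :: "'a set \<Rightarrow> ('a set + 'a set) pair_pre_digraph" where
  "component D = \<lparr> pverts = Inl ` left_in D \<union> Inr ` right_in D,
     parcs = Inl ` left_in D \<times> Inr ` right_in D \<union> Inr ` right_in D \<times> Inl ` left_in D \<rparr>"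

lemma complete_bipartite_component:
  assumes D: "D \<in> double_cosets G K H"
  shows "complete_bipartite_digraph (card (left_in D)) (card (left_in D)) (with_proj (component D))"
proof -
  have "card (Inl ` left_in D :: ('a set + 'a set) set) = card (left_in D)"
    "card (Inr ` right_in D :: ('a set + 'a set) set) = card (left_in D)"
    using card_right_in[OF D] by (simp_all add: card_image)
  moreover have "(Inl ` left_in D :: ('a set + 'a set) set) \<inter> Inr ` right_in D = {}" by auto
  moreover have "finite (pverts (component D))"
    using D by (simp add: component_def finite_left_in finite_right_in)
  ultimately show ?thesis
    unfolding complete_bipartite_digraph_pair_def component_def by auto
qed

lemma Int_nonempty:
  assumes "D \<in> double_cosets G K H" "A \<in> left_in D" "B \<in> right_in D"
  shows "A \<inter> B \<noteq> {}"
  using card_Int[OF assms] card_H_pos by auto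

text \<open>A shared vertex is a nonempty coset contained in both \<open>D\<close> and
  \<open>D'\<close>, and double cosets with a common element coincide.\<close>

lemma component_disjoint:
  assumes D: "D \<in> double_cosets G K H" "D' \<in> double_cosets G K H"
    and "pverts (component D) \<inter> pverts (component D') \<noteq> {}"
  shows "D = D'"
proof -
  obtain C where "C \<noteq> {}" "C \<subseteq> D" "C \<subseteq> D'"
    using assms(3) that[OF lcoset_nonempty] that[OF rcoset_nonempty]
    by (auto simp: component_def left_in_def right_in_def)
  then obtain x where "x \<in> D" "x \<in> D'" by blast
  then show ?thesis using double_cosetsD(1) D by metis
qed

lemma coset_graph_wf: "pair_wf_digraph (coset_graph G H K)"
  by unfold_locales (auto simp: coset_graph_def)

lemma component_subgraph:
  assumes D: "D \<in> double_cosets G K H"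
  shows "subgraph (with_proj (component D)) (with_proj (coset_graph G H K))"
proof (rule subgraphI)
  show "wf_digraph (with_proj (coset_graph G H K))"
    using coset_graph_wf by (auto simp: wf_digraph_wp_iff)
  show "wf_digraph (with_proj (component D))"
    by unfold_locales (auto simp: component_def)
  show "verts (with_proj (component D)) \<subseteq> verts (with_proj (coset_graph G H K))"
    by (auto simp: component_def coset_graph_def left_in_def right_in_def)
  show "arcs (with_proj (component D)) \<subseteq> arcs (with_proj (coset_graph G H K))"
    using Int_nonempty[OF D]
    by (auto simp: component_def coset_graph_def left_in_def right_in_def)
qed auto

lemma components_coset_graph:
  "components (with_proj (coset_graph G H K)) = (\<lambda>D. with_proj (component D)) ` double_cosets G K H"
proof (rule components_eq_partition)
  have "A \<in> \<Union>(left_in ` double_cosets G K H)" if "A \<in> lcosets H" for A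
    using that UN_left_in by simp
  moreover have "B \<in> \<Union>(right_in ` double_cosets G K H)" if "B \<in> rcosets K" for B
    using that UN_right_in by simp
  ultimately show "verts (with_proj (coset_graph G H K)) \<subseteq>
      (\<Union>C\<in>(\<lambda>D. with_proj (component D)) ` double_cosets G K H. verts C)"
    by (fastforce simp: coset_graph_def component_def)
next
  \<comment> \<open>An edge between \<open>A\<close> and \<open>B\<close> comes with some
    \<open>x\<close> in both; the double coset of \<open>x\<close> contains \<open>A\<close> as well
    as \<open>B\<close>.\<close>
  have "\<exists>D\<in>double_cosets G K H. A \<in> left_in D \<and> B \<in> right_in D"
    if AB: "A \<in> lcosets H" "B \<in> rcosets K" "x \<in> A" "x \<in> B" for A B x
  proof -
    obtain D where "D \<in> double_cosets G K H" "x \<in> D"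
      using double_coset_exists lcosetD(2)[OF AB(1,3)] by blast
    then show ?thesis using left_inI right_inI AB by blast
  qed
  then show "arcs (with_proj (coset_graph G H K)) \<subseteq>
      (\<Union>C\<in>(\<lambda>D. with_proj (component D)) ` double_cosets G K H. arcs C)"
    by (fastforce simp: coset_graph_def component_def)
next
  fix C assume "C \<in> (\<lambda>D. with_proj (component D)) ` double_cosets G K H"
  then show "subgraph C (with_proj (coset_graph G H K))" "connected C"
    using component_subgraph complete_bipartite_component card_left_in_pos
      complete_bipartite_digraph_connected by blast+
next
  fix C C' assume "C \<in> (\<lambda>D. with_proj (component D)) ` double_cosets G K H"
    "C' \<in> (\<lambda>D. with_proj (component D)) ` double_cosets G K H" and meet: "verts C \<inter> verts C' \<noteq> {}"
  then obtain D D' where D: "D \<in> double_cosets G K H" "C = with_proj (component D)"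
    "D' \<in> double_cosets G K H" "C' = with_proj (component D')" by blast
  then show "C = C'" using component_disjoint[of D D'] meet by simp
qed

lemma bij_betw_component:
  "bij_betw (\<lambda>D. with_proj (component D)) (double_cosets G K H)
     (components (with_proj (coset_graph G H K)))"
proof (rule bij_betw_imageI)
  show "inj_on (\<lambda>D. with_proj (component D)) (double_cosets G K H)"
  proof (rule inj_onI)
    fix D D' assume D: "D \<in> double_cosets G K H" "D' \<in> double_cosets G K H"
      and eq: "with_proj (component D) = with_proj (component D')"
    have "pverts (component D) = pverts (component D')"
      using arg_cong[OF eq, of verts] by simp
    moreover have "pverts (component D) \<noteq> {}"
      using card_left_in_pos[OF D(1)] by (auto simp: component_def)
    ultimately show "D = D'" using component_disjoint[OF D] by simp
  qed
qed (simp add: components_coset_graph)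

section \<open>Enumerations of the components\<close>

lemma component_enum_exists: "\<exists>\<Delta> t. component_enum G H K \<Delta> t"
proof -
  obtain e where e: "bij_betw e {1..card (double_cosets G K H)} (double_cosets G K H)"
    using ex_bij_betw_nat_finite_1[OF finite_double_cosets] by blast
  have "component_enum G H K ((\<lambda>D. with_proj (component D)) \<circ> e) (\<lambda>\<sigma>. card (left_in (e \<sigma>)))"
    unfolding component_enum_def
    using bij_betw_trans[OF e bij_betw_component] bij_betwE[OF e] complete_bipartite_component
    by simp
  then show ?thesis by blast
qed

text \<open>An arbitrary enumeration is one of the double cosets in disguise, which transfers the
  formulas over double cosets to every choice of \<open>\<Delta>\<close> and \<open>t\<close>. The
  numbers agree because both equal half the vertex count of the component.\<close>

lemma component_enum_double_cosets:
  assumes "component_enum G H K \<Delta> t"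
  obtains e where "bij_betw e {1..card (double_cosets G K H)} (double_cosets G K H)"
    and "\<And>\<sigma>. \<sigma> \<in> {1..card (double_cosets G K H)} \<Longrightarrow> t \<sigma> = card (left_in (e \<sigma>))"
proof -
  let ?S = "{1..card (double_cosets G K H)}"
  let ?c = "\<lambda>D. with_proj (component D)"
  \<comment> \<open>\<open>e \<sigma>\<close> is the double coset whose component is
    \<open>\<Delta> \<sigma>\<close>.\<close>
  define e where "e = inv_into (double_cosets G K H) ?c \<circ> \<Delta>"
  have \<Delta>: "bij_betw \<Delta> ?S (components (with_proj (coset_graph G H K)))"
    and cb: "\<And>\<sigma>. \<sigma> \<in> ?S \<Longrightarrow> complete_bipartite_digraph (t \<sigma>) (t \<sigma>) (\<Delta> \<sigma>)"
    using assms by (auto simp: component_enum_def)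
  have e: "bij_betw e ?S (double_cosets G K H)"
    unfolding e_def using \<Delta> bij_betw_inv_into[OF bij_betw_component] by (rule bij_betw_trans)
  moreover have "t \<sigma> = card (left_in (e \<sigma>))" if \<sigma>: "\<sigma> \<in> ?S" for \<sigma>
  proof -
    have "\<Delta> \<sigma> = ?c (e \<sigma>)"
      using bij_betw_inv_into_right[OF bij_betw_component] bij_betwE[OF \<Delta>] \<sigma>
      by (simp add: e_def)
    then have "complete_bipartite_digraph (card (left_in (e \<sigma>))) (card (left_in (e \<sigma>))) (\<Delta> \<sigma>)"
      using complete_bipartite_component bij_betwE[OF e] \<sigma> by simp
    from complete_bipartite_digraph_card_verts[OF this]
      complete_bipartite_digraph_card_verts[OF cb[OF \<sigma>]]
    show ?thesis by simp
  qed
  ultimately show ?thesis by (rule that)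
qed

end

theorem proposition3p2:
  fixes G :: "('a, 'b) monoid_scheme" and H K :: "'a set" and n s :: nat
  assumes "group G" and "finite (carrier G)"
    and "subgroup H G" and "subgroup K G"
    and "subgroup_index G H = n" and "subgroup_index G K = n"
    and "s = card (double_cosets G K H)"
  shows "(\<exists>\<Delta> t. component_enum G H K \<Delta> t) \<and>
    (\<forall>\<Delta> t. component_enum G H K \<Delta> t \<longrightarrow>
      DT_prob G H K = (\<Prod>\<sigma> = 1..s. fact (t \<sigma>) / real (t \<sigma>) ^ t \<sigma>) \<and>
      (\<forall>\<sigma> \<in> {1..s}. t \<sigma> dvd card H) \<and>
      (\<Sum>\<sigma> = 1..s. t \<sigma>) = n)"
proof -
  interpret group G by fact
  \<comment> \<open>Lagrange for both subgroups. As the order of \<open>G\<close> is nonzero, so is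
    \<open>n\<close>, and cancelling it turns equal indices into the equal orders that the locale
    assumes.\<close>
  have "n * card H = order G" "n * card K = order G"
    using l_lagrange[OF assms(2,3)] l_lagrange[OF assms(2,4)] assms(5,6)
    by (simp_all add: subgroup_index_def)
  moreover have "order G \<noteq> 0" using assms(2) order_gt_0_iff_finite by simp
  ultimately have "card H = card K" by (metis mult_cancel1 mult_is_0)
  then interpret equicardinal_subgroups G H K
    using assms by (intro equicardinal_subgroups.intro equicardinal_subgroups_axioms.intro)
  show ?thesis
  proof (intro conjI allI impI)
    fix \<Delta> t assume "component_enum G H K \<Delta> t"
    then obtain e where e: "bij_betw e {1..s} (double_cosets G K H)"
      and t: "\<And>\<sigma>. \<sigma> \<in> {1..s} \<Longrightarrow> t \<sigma> = card (left_in (e \<sigma>))"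
      by (rule component_enum_double_cosets[folded assms(7)]) blast
    show "DT_prob G H K = (\<Prod>\<sigma> = 1..s. fact (t \<sigma>) / real (t \<sigma>) ^ t \<sigma>)"
      unfolding DT_prob_eq prod.reindex_bij_betw[OF e, symmetric] by (simp add: t)
    show "\<forall>\<sigma> \<in> {1..s}. t \<sigma> dvd card H"
      using t card_left_in_dvd bij_betwE[OF e] by simp
    show "(\<Sum>\<sigma> = 1..s. t \<sigma>) = n"
      using assms(5) sum_card_left_in
      unfolding subgroup_index_def sum.reindex_bij_betw[OF e, symmetric] by (simp add: t)
  qed (rule component_enum_exists)
qed

end
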